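(* Let $$\gamma=\begin{pmatrix}a&b\\c&d\end{pmatrix},\ \gamma'=\begin{pmatrix}a'&b'\\c'&d'\end{pmatrix}\in\mathrm{SL}_2(\mathbb{Z}).$$ Set $\ell:=\gcd(\ell_\gamma,\ell_{\gamma'})$. If $c$, $c'$, and $ca'+dc'$ are positive, then $$\mathrm{G}_0(\ell^{-1}T_{\gamma\gamma'},m)=\mathrm{G}_0(\ell^{-1}T_\gamma,m)+\mathrm{G}_0(\ell^{-1}T_{\gamma'},m)+\{m/\ell\}-1$$ for all $m\in\mathbb{Z}_{\geq0}$.
   Context: For $\gamma=\begin{pmatrix}a&b\\c&d\end{pmatrix}\in\mathrm{SL}_2(\mathbb{Z})$, the content of $\gamma$ is $\ell_\gamma:=\gcd(c,a-1)$. If $c\neq0$, $T_\gamma$ is the triangle in $\mathbb{R}^2$ with vertices $(0,0)$, $(a-1,c)$, $(-1,0)$. For $y\in\mathbb{R}$, $\{y\}=y-\lfloor y\rfloor$. For a triangle $T\subset\mathbb{R}^2$ with vertices in $\mathbb{Q}^2$ and $m\in\mathbb{Z}_{\ge0}$, put $\mathrm{G}(T,m):=\#(\mathbb{Z}^2\cap mT)$. Let $\mathrm{den}(T)$ be the smallest positive integer $D$ such that $DT$ has vertices in $\mathbb{Z}^2$. By Ehrhart's theorem, $\mathrm{G}(T,m)=\mathrm{G}_2(T,m)m^2+\mathrm{G}_1(T,m)m+\mathrm{G}_0(T,m)$ for all $m\in\mathbb{Z}_{\ge0}$, where each $\mathrm{G}_i(T,\cdot):\mathbb{Z}_{\ge0}\to\mathbb{R}$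 is (uniquely determined as) a function with $\mathrm{G}_i(T,m+\mathrm{den}(T))=\mathrm{G}_i(T,m)$ for all $m$; $\mathrm{G}_0(T,\cdot)$ is the $0$th coefficient. *)

theory Defs
  imports "HOL-Analysis.Analysis"
begin

definition SL2Z :: "(int^2^2) set" where
  "SL2Z = {\<gamma>. det \<gamma> = 1}"

definition sl2_content :: "int^2^2 \<Rightarrow> int" where
  "sl2_content \<gamma> = gcd (\<gamma>$2$1) (\<gamma>$1$1 - 1)"

text \<open>Of interest only when the lower left entry is nonzero; otherwise the hull degenerates.\<close>
definition sl2_triangle :: "int^2^2 \<Rightarrow> (real^2) set" where
  "sl2_triangle \<gamma> =
     convex hull {vector [0, 0],
                  vector [of_int (\<gamma>$1$1 - 1), of_int (\<gamma>$2$1)],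
                  vector [-1, 0]}"

definition dilate :: "real \<Rightarrow> (real^2) set \<Rightarrow> (real^2) set" where
  "dilate r T = (\<lambda>x. r *\<^sub>R x) ` T"

definition int_lattice :: "(real^2) set" where
  "int_lattice = {x. \<forall>i. x$i \<in> \<int>}"

definition lattice_count :: "(real^2) set \<Rightarrow> nat \<Rightarrow> nat" where
  "lattice_count T m = card (int_lattice \<inter> dilate (real m) T)"

text \<open>The vertices of a triangle, given as a set of points, are its extreme points.\<close>
definition den :: "(real^2) set \<Rightarrow> nat" where
  "den T = (LEAST D. D > 0 \<and> (\<forall>v. v extreme_point_of dilate (real D) T \<longrightarrow> v \<in> int_lattice))"

definition ehrhart_coeffs ::
  "(real^2) set \<Rightarrow> (nat \<Rightarrow> real) \<Rightarrow> (nat \<Rightarrow> real) \<Rightarrow> (nat \<Rightarrow> real) \<Rightarrow> bool" where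
  "ehrhart_coeffs T g\<^sub>0 g\<^sub>1 g\<^sub>2 \<longleftrightarrow>
     (\<forall>m. g\<^sub>0 (m + den T) = g\<^sub>0 m \<and> g\<^sub>1 (m + den T) = g\<^sub>1 m \<and> g\<^sub>2 (m + den T) = g\<^sub>2 m) \<and>
     (\<forall>m. real (lattice_count T m) = g\<^sub>2 m * (real m)\<^sup>2 + g\<^sub>1 m * real m + g\<^sub>0 m)"

text \<open>Existence and uniqueness of the coefficients, for triangles with rational vertices, are
  Ehrhart's theorem; the description below is meaningful only for such sets.\<close>
definition G\<^sub>0 :: "(real^2) set \<Rightarrow> nat \<Rightarrow> real" where
  "G\<^sub>0 T = (THE g\<^sub>0. \<exists>g\<^sub>1 g\<^sub>2. ehrhart_coeffs T g\<^sub>0 g\<^sub>1 g\<^sub>2)"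

end

theory Submission
  imports Defs
begin

text \<open>
  Write \<open>e = (1, 0)\<close>. Translating the triangle of \<open>\<gamma>\<close> by \<open>e\<close> turns its vertices into
  \<open>O = 0\<close>, \<open>P = e\<close> and \<open>Q = \<gamma> e\<close>; put \<open>R = \<gamma> \<gamma>' e\<close>. Then \<open>O P Q\<close> is the
  triangle of \<open>\<gamma>\<close>, \<open>O P R\<close> is that of \<open>\<gamma> \<gamma>'\<close>, and \<open>O Q R\<close> is the image under \<open>\<gamma>\<close> of that of
  \<open>\<gamma>'\<close>. The three positivity hypotheses say that \<open>P\<close>, \<open>Q\<close>, \<open>R\<close> are met in this order
  when turning counterclockwise around \<open>O\<close> by less than a half turn. Hence \<open>O P Q\<close> and \<open>O Q R\<close>
  meet exactly in the segment \<open>O Q\<close>, and their union differs from \<open>O P R\<close> by the triangle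
  \<open>P Q R\<close>, up to boundary: it contains \<open>P Q R\<close> in addition when \<open>Q\<close> lies beyond \<open>P R\<close>, and
  lacks it when \<open>Q\<close> lies inside \<open>O P R\<close>.

  Now dilate by \<open>m / \<ell>\<close>, choosing the lattice so that \<open>P\<close> is a lattice point. By the choice of
  \<open>\<ell>\<close>, the points \<open>Q - P\<close> and \<open>R - P\<close> are divisible by \<open>\<ell>\<close>. So \<open>P Q R\<close> becomes
  the \<open>m\<close>-fold dilate of a lattice triangle, and without the edges that it shares with the triangles
  already counted it has \<open>A m\<^sup>2 + B m\<close> lattice points, without constant term. The segment \<open>O Q\<close> contains
  \<open>\<lfloor>m/\<ell>\<rfloor> + 1 = m/\<ell> + 1 - {m/\<ell>}\<close> lattice points, with constant coefficient
  \<open>1 - {m/\<ell>}\<close>. Comparing constant coefficients in the inclusion-exclusion formula gives the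
  theorem.

  The decomposition, with its count, is \<open>triangle_points_cut_and_paste\<close>; the identification of
  \<open>O Q R\<close> with the triangle of \<open>\<gamma>'\<close> is \<open>card_adjacent_triangle_points\<close>. The constant
  coefficient can be read off only when the counting function is known to be a
  quasi-polynomial (\<open>triangle_points_quasi_polynomial\<close>) whose period divides the denominator of
  the triangle (\<open>den_scaled_sl2_triangle\<close>). Below, \<open>n\<close> is the natural number \<open>\<ell>\<close>, the origin is at
  \<open>P\<close>, and \<open>Q - P = n (p, q)\<close>, \<open>R - P = n (p2, q2)\<close> before dilation.
\<close>

section \<open>Counting by finite differences\<close>

text \<open>
  The set counted by \<open>N m\<close> consists of the lattice points of the \<open>m\<close>-fold dilate of the triangle
  with vertices \<open>0\<close>, \<open>v\<close>, \<open>u / n\<close>; the parameters \<open>t\<close> and \<open>e\<close> equal \<open>1\<close> where an edge is to be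
  removed. Translation by \<open>v\<close> embeds the \<open>m\<close>-th dilate into the next one and misses only a
  strip \<open>0 \<le> f < d\<close>. Translation by \<open>u\<close> embeds the \<open>m\<close>-th strip into the \<open>(m + n)\<close>-th
  one and misses only a fundamental parallelogram, whose cardinality \<open>F\<close> does not depend on \<open>m\<close>.
\<close>
lemma lattice_triangle_second_difference:
  fixes f g :: "int \<times> int \<Rightarrow> int" and u v :: "int \<times> int" and d t e :: int and n :: nat
  assumes f_add: "\<And>z w. f (z + w) = f z + f w" and g_add: "\<And>z w. g (z + w) = g z + g w"
    and inj: "inj (\<lambda>z. (f z, g z))"
    and u: "f u = 0" "g u = d" and v: "f v = d" "g v = 0"
    and d: "d > 0" and n: "n > 0" and t: "0 \<le> t" "t \<le> 1" and e: "0 \<le> e" "e \<le> 1"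
  defines "N \<equiv> \<lambda>m::nat. card {z. 0 \<le> f z \<and> t \<le> g z \<and> f z + int n * g z \<le> int m * d - e}"
  shows "\<exists>F. \<forall>m. N (m + n + 1) + N m = N (m + n) + N (m + 1) + F"
proof -
  define T where
    "T = (\<lambda>m::nat. {z. 0 \<le> f z \<and> t \<le> g z \<and> f z + int n * g z \<le> int m * d - e})"
  define R where "R = (\<lambda>m. {z \<in> T m. f z < d})"
  define Q where "Q = {z. 0 \<le> f z \<and> f z < d \<and> t \<le> g z \<and> g z < d + t}"
  have fin: "finite (T m)" for m
  proof (rule inj_on_finite[of "\<lambda>z. (f z, g z)" _ "{0..int m * d} \<times> {0..int m * d}"])
    show "inj_on (\<lambda>z. (f z, g z)) (T m)"
      using inj by (rule inj_on_subset) simp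
    have "g z \<le> int n * g z" if "t \<le> g z" for z
      using that n t mult_right_mono[of 1 "int n" "g z"] by simp
    then show "(\<lambda>z. (f z, g z)) ` T m \<subseteq> {0..int m * d} \<times> {0..int m * d}"
      using e t unfolding T_def by (smt (verit) atLeastAtMost_iff image_subsetI mem_Collect_eq mem_Sigma_iff)
  qed simp
  then have finR: "finite (R m)" for m by (simp add: R_def)
  have f_diff: "f (z - w) = f z - f w" and g_diff: "g (z - w) = g z - g w" for z w
    using f_add[of "z - w" w] g_add[of "z - w" w] by simp_all
  have T_step: "T (Suc m) = R (Suc m) \<union> (\<lambda>z. z + v) ` T m" for m
  proof (intro set_eqI iffI)
    fix z assume z: "z \<in> T (Suc m)"
    show "z \<in> R (Suc m) \<union> (\<lambda>z. z + v) ` T m"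
    proof (cases "f z < d")
      case False
      then have "z - v \<in> T m"
        using z by (auto simp: T_def f_diff g_diff v algebra_simps)
      then have "z - v + v \<in> (\<lambda>z. z + v) ` T m" by (rule imageI)
      then show ?thesis by simp
    qed (use z in \<open>simp add: R_def\<close>)
  next
    fix z assume "z \<in> R (Suc m) \<union> (\<lambda>z. z + v) ` T m"
    then show "z \<in> T (Suc m)"
      using d by (auto simp: T_def R_def f_add g_add v algebra_simps)
  qed
  have N_step: "N (Suc m) = card (R (Suc m)) + N m" for m
  proof -
    have "card (T (Suc m)) = card (R (Suc m)) + card ((\<lambda>z. z + v) ` T m)"
      unfolding T_step
      by (rule card_Un_disjoint[OF finR finite_imageI[OF fin]]) (auto simp: R_def T_def f_add v)
    then show ?thesis
      by (simp add: N_def T_def card_image)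
  qed
  have R_step: "R (Suc m + n) = Q \<union> (\<lambda>z. z + u) ` R (Suc m)" for m
  proof (intro set_eqI iffI)
    fix z assume z: "z \<in> R (Suc m + n)"
    show "z \<in> Q \<union> (\<lambda>z. z + u) ` R (Suc m)"
    proof (cases "g z < d + t")
      case False
      then have "z - u \<in> R (Suc m)"
        using z by (auto simp: R_def T_def f_diff g_diff u algebra_simps)
      then have "z - u + u \<in> (\<lambda>z. z + u) ` R (Suc m)" by (rule imageI)
      then show ?thesis by simp
    qed (use z in \<open>simp add: Q_def R_def T_def\<close>)
  next
    fix z assume z: "z \<in> Q \<union> (\<lambda>z. z + u) ` R (Suc m)"
    show "z \<in> R (Suc m + n)"
    proof (cases "z \<in> Q")
      case True
      (* The parallelogram fits below the slanted edge only because the index is at least n + 1: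
         strips are compared from the first one on, never the degenerate strip of index 0. *)
      then have "g z \<le> d" "f z \<le> d - 1" using t by (auto simp: Q_def)
      moreover from this have "int n * g z \<le> int n * d" by (intro mult_left_mono) auto
      moreover have "0 \<le> int m * d" using d by simp
      ultimately have "f z + int n * g z \<le> (1 + int m + int n) * d - e"
        using e by (simp add: algebra_simps)
      then show ?thesis using True by (simp add: Q_def R_def T_def add.assoc)
    next
      case False
      then show ?thesis
        using z d by (auto simp: R_def T_def f_add g_add u algebra_simps)
    qed
  qed
  have "card (R (Suc m + n)) = card Q + card (R (Suc m))" for m
  proof -
    have "finite Q" using R_step[of 0] finR[of "Suc 0 + n"] by simp
    then have "card (R (Suc m + n)) = card Q + card ((\<lambda>z. z + u) ` R (Suc m))"
      unfolding R_step
      by (rule card_Un_disjoint[OF _ finite_imageI[OF finR]]) (auto simp: Q_def R_def T_def g_add u)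
    then show ?thesis by (simp add: card_image)
  qed
  then have "N (m + n + 1) + N m = N (m + n) + N (m + 1) + card Q" for m
    using N_step[of "m + n"] N_step[of m] by simp
  then show ?thesis by blast
qed

text \<open>
  Such a recurrence makes \<open>N (m + n) - N m\<close> an affine function of \<open>m\<close>, which is also the
  \<open>n\<close>-step difference of a quadratic polynomial; subtracting the polynomial leaves a periodic
  remainder. In particular only the constant coefficient oscillates.
\<close>
lemma quasi_polynomial_of_second_difference:
  fixes N :: "nat \<Rightarrow> nat"
  assumes "n > 0" and step: "\<And>m. N (m + n + 1) + N m = N (m + n) + N (m + 1) + F"
  shows "\<exists>A B g. (\<forall>m. g (m + n) = g m) \<and> (\<forall>m. real (N m) = A * (real m)\<^sup>2 + B * real m + g m)"
proof -
  have diff: "real (N (m + n)) = real (N m) + F * m + (real (N n) - real (N 0))" for m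
  proof (induction m)
    case (Suc m)
    have "real (N (m + n + 1)) + N m = real (N (m + n)) + N (m + 1) + F"
      using step[of m] by (metis of_nat_add)
    with Suc show ?case by (simp add: algebra_simps)
  qed simp
  define A where "A = F / (2 * real n)"
  define B where "B = (real (N n) - real (N 0)) / n - F / 2"
  define g where "g = (\<lambda>m. real (N m) - A * (real m)\<^sup>2 - B * real m)"
  have An: "A * n = F / 2" and Bn: "B * n = (real (N n) - real (N 0)) - F / 2 * n"
    using \<open>n > 0\<close> by (simp_all add: A_def B_def field_simps)
  have "g (m + n) = g m" for m
  proof -
    have "g (m + n) - g m = F * m + (real (N n) - real (N 0)) - (A * n) * (2 * m + n) - B * n"
      unfolding g_def diff by (simp add: power2_eq_square algebra_simps)
    also have "\<dots> = 0"
      unfolding An Bn by (simp add: algebra_simps)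
    finally show ?thesis by simp
  qed
  moreover have "real (N m) = A * (real m)\<^sup>2 + B * real m + g m" for m
    by (simp add: g_def)
  ultimately show ?thesis by blast
qed

lemma period_one_imp_constant:
  fixes g :: "nat \<Rightarrow> real"
  assumes "\<And>m. g (m + 1) = g m"
  shows "g m = g 0"
  using assms by (induction m) auto

text \<open>
  The lattice points of the triangle with vertices \<open>0\<close>, \<open>(m p, m q)\<close>, \<open>(- m / n, 0)\<close>, for \<open>q > 0\<close>
  and \<open>n > 0\<close>. The edge with the rational end point still has an integral equation, because
  its direction \<open>(p + 1 / n, q)\<close> becomes integral after multiplication by \<open>n\<close>.
\<close>
definition triangle_points :: "nat \<Rightarrow> int \<Rightarrow> int \<Rightarrow> nat \<Rightarrow> (int \<times> int) set" where
  "triangle_points n p q m =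
     {(x, y). 0 \<le> y \<and> 0 \<le> p * y - q * x \<and> y + int n * (p * y - q * x) \<le> q * int m}"

lemma triangle_points_quasi_polynomial:
  assumes "n > 0" "q > 0"
  shows "\<exists>A B g. (\<forall>m. g (m + n) = g m) \<and>
    (\<forall>m. real (card (triangle_points n p q m)) = A * (real m)\<^sup>2 + B * real m + g m)"
proof -
  have "inj (\<lambda>z::int \<times> int. (snd z, p * snd z - q * fst z))"
    using assms by (auto intro!: injI)
  then obtain F where "\<And>m.
      card {z. 0 \<le> snd z \<and> 0 \<le> p * snd z - q * fst z \<and>
        snd z + int n * (p * snd z - q * fst z) \<le> int (m + n + 1) * q - 0} +
      card {z. 0 \<le> snd z \<and> 0 \<le> p * snd z - q * fst z \<and>
        snd z + int n * (p * snd z - q * fst z) \<le> int m * q - 0} =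
      card {z. 0 \<le> snd z \<and> 0 \<le> p * snd z - q * fst z \<and>
        snd z + int n * (p * snd z - q * fst z) \<le> int (m + n) * q - 0} +
      card {z. 0 \<le> snd z \<and> 0 \<le> p * snd z - q * fst z \<and>
        snd z + int n * (p * snd z - q * fst z) \<le> int (m + 1) * q - 0} + F"
    using lattice_triangle_second_difference[of snd "\<lambda>z. p * snd z - q * fst z" "(-1, 0)" q "(p, q)" n 0 0]
      assms by (auto simp: algebra_simps)
  moreover have "triangle_points n p q m = {z. 0 \<le> snd z \<and> 0 \<le> p * snd z - q * fst z \<and>
      snd z + int n * (p * snd z - q * fst z) \<le> int m * q - 0}" for m
    by (auto simp: triangle_points_def mult.commute)
  ultimately have "\<And>m. card (triangle_points n p q (m + n + 1)) + card (triangle_points n p q m) =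
      card (triangle_points n p q (m + n)) + card (triangle_points n p q (m + 1)) + F"
    by simp
  then show ?thesis
    by (rule quasi_polynomial_of_second_difference[OF \<open>n > 0\<close>])
qed

text \<open>
  The triangle \<open>P Q R\<close> without one edge (\<open>e = 0\<close>) or without two of them (\<open>e = 1\<close>). It is a lattice
  triangle, so the oscillating coefficient is constant, and its value is the number of points for
  \<open>m = 0\<close>. That number is \<open>0\<close> instead of \<open>1\<close> because removing an edge removes the apex.
\<close>
lemma half_open_lattice_triangle_polynomial:
  fixes p q p2 q2 e :: int
  defines "k \<equiv> p * q2 - q * p2"
  assumes "k > 0" "0 \<le> e" "e \<le> 1"
  shows "\<exists>A B. \<forall>m. real (card {(x, y). 0 \<le> p * y - q * x \<and> p2 * y - q2 * x < 0 \<and>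
      (p * y - q * x) - (p2 * y - q2 * x) \<le> int m * k - e}) = A * (real m)\<^sup>2 + B * real m"
proof -
  define f where "f = (\<lambda>z. p * snd z - q * fst z)"
  define g where "g = (\<lambda>z. q2 * fst z - p2 * snd z)"
  define N where
    "N = (\<lambda>m::nat. card {z. 0 \<le> f z \<and> 1 \<le> g z \<and> f z + int 1 * g z \<le> int m * k - e})"
  have inj: "inj (\<lambda>z. (f z, g z))"
  proof (rule injI)
    fix z w assume eq: "(f z, g z) = (f w, g w)"
    have "k * fst x = p2 * f x + p * g x" "k * snd x = q2 * f x + q * g x" for x
      by (simp_all add: k_def f_def g_def algebra_simps)
    with eq have "k * fst z = k * fst w" "k * snd z = k * snd w" by simp_all
    with \<open>k > 0\<close> show "z = w" by (simp add: prod_eq_iff)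
  qed
  have "\<exists>F. \<forall>m. N (m + 1 + 1) + N m = N (m + 1) + N (m + 1) + F"
    unfolding N_def
    by (rule lattice_triangle_second_difference[OF _ _ inj, of "(p, q)" k "(p2, q2)"])
      (use assms in \<open>simp_all add: f_def g_def k_def algebra_simps\<close>)
  then obtain F where "\<And>m. N (m + 1 + 1) + N m = N (m + 1) + N (m + 1) + F" by blast
  from quasi_polynomial_of_second_difference[of 1 N, OF _ this]
  obtain A B h where "\<And>m. h (m + 1) = h m"
    and poly: "\<And>m. real (N m) = A * (real m)\<^sup>2 + B * real m + h m"
    by auto
  then have "h m = h 0" for m by (intro period_one_imp_constant)
  moreover have "N 0 = 0"
  proof -
    have "{z. 0 \<le> f z \<and> 1 \<le> g z \<and> f z + int 1 * g z \<le> int 0 * k - e} = {}"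
      using assms by auto
    then show ?thesis by (simp only: N_def card.empty)
  qed
  ultimately have "real (N m) = A * (real m)\<^sup>2 + B * real m" for m
    using poly[of 0] poly[of m] by simp
  moreover have "{(x, y). 0 \<le> p * y - q * x \<and> p2 * y - q2 * x < 0 \<and>
      (p * y - q * x) - (p2 * y - q2 * x) \<le> int m * k - e} =
      {z. 0 \<le> f z \<and> 1 \<le> g z \<and> f z + int 1 * g z \<le> int m * k - e}" for m
    by (auto simp: f_def g_def)
  ultimately show ?thesis unfolding N_def by auto
qed

section \<open>The quadrilateral and its diagonals\<close>

lemma finite_triangle_points:
  assumes "n > 0" "q > 0"
  shows "finite (triangle_points n p q m)"
proof (rule inj_on_finite[of "\<lambda>(x, y). (y, p * y - q * x)" _ "{0..q * int m} \<times> {0..q * int m}"])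
  show "inj_on (\<lambda>(x, y). (y, p * y - q * x)) (triangle_points n p q m)"
    using assms by (auto simp: inj_on_def)
  have bound: "y \<le> q * int m \<and> s \<le> q * int m" if "0 \<le> y" "0 \<le> s" "y + int n * s \<le> q * int m" for y s
    using that assms mult_right_mono[of 1 "int n" s] by simp
  show "(\<lambda>(x, y). (y, p * y - q * x)) ` triangle_points n p q m
      \<subseteq> {0..q * int m} \<times> {0..q * int m}"
  proof (rule image_subsetI)
    fix z assume "z \<in> triangle_points n p q m"
    then show "(\<lambda>(x, y). (y, p * y - q * x)) z \<in> {0..q * int m} \<times> {0..q * int m}"
      using bound[of "snd z" "p * snd z - q * fst z"] by (cases z) (simp add: triangle_points_def)
  qed
qed simp

text \<open>
  The lattice points of the triangle \<open>O Q R\<close> dilated by \<open>m / n\<close>, in the frame where \<open>P\<close> is the origin: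
  \<open>O = (- m / n, 0)\<close>, \<open>Q = m (p, q)\<close>, \<open>R = m (p2, q2)\<close>. The inequalities correspond to
  the edges \<open>O Q\<close>, \<open>O R\<close> and \<open>Q R\<close>.
\<close>
definition adjacent_triangle_points ::
    "nat \<Rightarrow> int \<Rightarrow> int \<Rightarrow> int \<Rightarrow> int \<Rightarrow> nat \<Rightarrow> (int \<times> int) set" where
  "adjacent_triangle_points n p q p2 q2 m =
     {(x, y). q * int m \<le> y + int n * (p * y - q * x) \<and>
        y + int n * (p2 * y - q2 * x) \<le> q2 * int m \<and>
        0 \<le> (p2 * y - q2 * x) - (p * y - q * x) + (p * q2 - q * p2) * int m}"

text \<open>
  The segment \<open>O Q\<close> has the direction of the primitive vector \<open>(1 + n p, n q)\<close>, the first column of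
  \<open>\<gamma>\<close>. Its end \<open>Q\<close> is a lattice point, and its length is \<open>m / n\<close> times that of the vector.
\<close>
lemma card_diagonal_points:
  assumes n: "n > 0" and q: "q > 0" and cop: "coprime (1 + int n * p) q"
  shows "card {(x, y). 0 \<le> y \<and> 0 \<le> p * y - q * x \<and> y + int n * (p * y - q * x) = q * int m}
    = m div n + 1" (is "card ?S = _")
proof -
  (* The k-th lattice point on the way from Q to O. *)
  define h where
    "h = (\<lambda>k::int. (p * int m - k * (1 + int n * p), q * (int m - k * int n)))"
  have bound: "k \<le> int (m div n) \<longleftrightarrow> 0 \<le> int m - k * int n" for k
  proof
    assume "k \<le> int (m div n)"
    then have "k * int n \<le> int (m div n) * int n" by (intro mult_right_mono) auto
    also have "\<dots> \<le> int m"
      using div_times_less_eq_dividend[of m n] by (metis of_nat_le_iff of_nat_mult)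
    finally show "0 \<le> int m - k * int n" by simp
  next
    assume "0 \<le> int m - k * int n"
    then show "k \<le> int (m div n)"
      using zdiv_mono1[of "k * int n" "int m" "int n"] n by (simp add: zdiv_int)
  qed
  have "?S = h ` {0..int (m div n)}"
  proof (intro set_eqI iffI)
    fix z assume "z \<in> ?S"
    then obtain x y where z: "z = (x, y)" and ge: "0 \<le> y" "0 \<le> p * y - q * x"
      and eq: "y + int n * (p * y - q * x) = q * int m" by auto
    have "(1 + int n * p) * y = q * (int m + int n * x)"
      using eq by (simp add: algebra_simps)
    then have "q dvd (1 + int n * p) * y" by simp
    then have "q dvd y"
      using cop by (metis coprime_commute coprime_dvd_mult_right_iff)
    then obtain j where j: "y = q * j" by blast
    with eq q have "q * (j + int n * (p * j - x)) = q * int m"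
      by (simp add: algebra_simps)
    then have j_eq: "j + int n * (p * j - x) = int m" using q by simp
    define k where "k = p * j - x"
    have j_k: "j = int m - k * int n" using j_eq by (simp add: k_def algebra_simps)
    have "x = p * j - k" by (simp add: k_def)
    then have "x = p * int m - k * (1 + int n * p)" using j_k by (simp add: algebra_simps)
    then have "z = h k" using z j j_k by (simp add: h_def)
    moreover have "0 \<le> j" using ge(1) q j by (simp add: zero_le_mult_iff)
    moreover have "0 \<le> q * k" using ge(2) j by (simp add: k_def algebra_simps)
    ultimately show "z \<in> h ` {0..int (m div n)}"
      using q j_k bound[of k] by (auto simp: zero_le_mult_iff)
  next
    fix z assume "z \<in> h ` {0..int (m div n)}"
    then obtain k where k: "0 \<le> k" "0 \<le> int m - k * int n" "z = h k"
      using bound by auto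
    have s: "p * (q * (int m - k * int n)) - q * (p * int m - k * (1 + int n * p)) = q * k"
      by (simp add: algebra_simps)
    have "q * (int m - k * int n) + int n * (q * k) = q * int m"
      by (simp add: algebra_simps)
    then show "z \<in> ?S"
      unfolding k(3) h_def mem_Collect_eq case_prod_conv s using k q by simp
  qed
  moreover have "inj_on h {0..int (m div n)}"
    using n q by (auto simp: h_def inj_on_def)
  ultimately show ?thesis by (simp add: card_image)
qed

text \<open>
  Inclusion-exclusion for the closed triangles \<open>O P Q\<close>, \<open>O Q R\<close> and \<open>O P R\<close>. The sign of the
  determinant \<open>k\<close> tells on which side of the line \<open>P R\<close> the point \<open>Q\<close> lies, and thus whether the points of
  \<open>P Q R\<close> are added or removed; this triangle enters the polynomial part only. The numbers
  \<open>n q\<close>, \<open>n q2\<close> and \<open>n (q2 - q + n k)\<close> are twice the areas of \<open>O P Q\<close>, \<open>O P R\<close> and \<open>O Q R\<close> before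
  dilation, so their positivity fixes the cyclic order of \<open>P\<close>, \<open>Q\<close>, \<open>R\<close> around \<open>O\<close>.
\<close>
lemma triangle_points_cut_and_paste:
  fixes p q p2 q2 :: int
  defines "k \<equiv> p * q2 - q * p2"
  assumes n: "n > 0" and q: "q > 0" and q2: "q2 > 0" and q': "q2 - q + int n * k > 0"
    and cop: "coprime (1 + int n * p) q"
  shows "\<exists>A B. \<forall>m. real (card (triangle_points n p2 q2 m)) + real (m div n + 1) =
    real (card (triangle_points n p q m)) + real (card (adjacent_triangle_points n p q p2 q2 m))
    + A * (real m)\<^sup>2 + B * real m"
proof -
  define T1 where "T1 = triangle_points n p q"
  define T2 where "T2 = triangle_points n p2 q2"
  define U where "U = adjacent_triangle_points n p q p2 q2"
  define q' where "q' = q2 - q + int n * k"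
  have "q' > 0" using q' by (simp add: q'_def)
  (* Each of these affine functions vanishes on one line of the dilated figure:
     snd on OP, s1 on PQ, s2 on PR, b on OQ, r on OR, e on QR. *)
  define s1 where "s1 = (\<lambda>z. p * snd z - q * fst z)"
  define s2 where "s2 = (\<lambda>z. p2 * snd z - q2 * fst z)"
  define b where "b = (\<lambda>m z. snd z + int n * s1 z - q * int m)"
  define r where "r = (\<lambda>m z. snd z + int n * s2 z - q2 * int m)"
  define e where "e = (\<lambda>m z. s2 z - s1 z + k * int m)"
  have T1: "z \<in> T1 m \<longleftrightarrow> 0 \<le> snd z \<and> 0 \<le> s1 z \<and> b m z \<le> 0" for z m
    by (cases z) (auto simp: T1_def triangle_points_def s1_def b_def)
  have T2: "z \<in> T2 m \<longleftrightarrow> 0 \<le> snd z \<and> 0 \<le> s2 z \<and> r m z \<le> 0" for z m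
    by (cases z) (auto simp: T2_def triangle_points_def s2_def r_def)
  have U: "z \<in> U m \<longleftrightarrow> 0 \<le> b m z \<and> r m z \<le> 0 \<and> 0 \<le> e m z" for z m
    by (cases z) (auto simp: U_def adjacent_triangle_points_def s1_def s2_def r_def b_def e_def k_def)
  (* Three of these lines meet in each of the vertices P, O, Q, R, which gives one linear relation
     per vertex. All coefficients except k are positive, so every inclusion below is a matter
     of comparing signs in one of these relations. *)
  have rel1: "q2 * s1 z = q * s2 z + k * snd z" for z
    by (simp add: s1_def s2_def k_def algebra_simps)
  have rel2: "q2 * b m z = q' * snd z + q * r m z" for m z
    by (simp add: s1_def s2_def k_def b_def r_def q'_def algebra_simps)
  have rel3: "q' * s1 z = q * e m z + k * b m z" for m z
    by (simp add: s1_def s2_def k_def b_def e_def q'_def algebra_simps)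
  have rel4: "q' * s2 z = q2 * e m z + k * r m z" for m z
    by (simp add: s1_def s2_def k_def r_def e_def q'_def algebra_simps)
  have fin: "finite (T1 m)" "finite (T2 m)" for m
    using finite_triangle_points n q q2 by (auto simp: T1_def T2_def)
  have fin_U: "finite (U m)" for m
  proof (rule inj_on_finite[of "\<lambda>z. (b m z, r m z)" _ "{0..q' * int m} \<times> {- (q' * int m)..0}"])
    show "inj_on (\<lambda>z. (b m z, r m z)) (U m)"
    proof (rule inj_onI)
      fix z w assume eq: "(b m z, r m z) = (b m w, r m w)"
      then have eqs: "b m z = b m w" "r m z = r m w" by simp_all
      have "q' * snd z = q' * snd w"
        using rel2[of m z, unfolded eqs] rel2[of m w] by linarith
      then have "snd z = snd w" using \<open>q' > 0\<close> by simp
      moreover from this eqs have "fst z = fst w" using n q by (simp add: b_def s1_def)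
      ultimately show "z = w" by (simp add: prod_eq_iff)
    qed
    have e_eq: "int n * e m z = r m z - b m z + q' * int m" for z
      by (simp add: b_def r_def e_def q'_def algebra_simps)
    show "(\<lambda>z. (b m z, r m z)) ` U m \<subseteq> {0..q' * int m} \<times> {- (q' * int m)..0}"
    proof (rule image_subsetI)
      fix z assume z: "z \<in> U m"
      then have "0 \<le> int n * e m z" using U by simp
      with z show "(b m z, r m z) \<in> {0..q' * int m} \<times> {- (q' * int m)..0}"
        unfolding e_eq U by simp
    qed
  qed simp
  have pos: "0 \<le> a" if "0 \<le> c * a" "c > 0" for a c :: int
    using that by (simp add: zero_le_mult_iff)
  have neg: "a \<le> 0" if "c * a \<le> 0" "c > 0" for a c :: int
    using that by (simp add: mult_le_0_iff)
  note sign = mult_nonneg_nonneg mult_nonneg_nonpos mult_nonpos_nonneg mult_nonpos_nonpos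
  have U_upper: "0 \<le> snd z" if "z \<in> U m" for z m
  proof (rule pos[OF _ \<open>q' > 0\<close>])
    have "0 \<le> q2 * b m z" "q * r m z \<le> 0"
      using that U q q2 by (simp_all add: sign)
    then show "0 \<le> q' * snd z" using rel2[of m z] by linarith
  qed
  have T1_below: "r m z \<le> 0" if "z \<in> T1 m" for z m
  proof (rule neg[OF _ \<open>q > 0\<close>])
    have "q2 * b m z \<le> 0" "0 \<le> q' * snd z"
      using that T1 \<open>q' > 0\<close> q2 by (simp_all add: sign)
    then show "q * r m z \<le> 0" using rel2[of m z] by linarith
  qed
  have inter: "T1 m \<inter> U m = {(x, y). 0 \<le> y \<and> 0 \<le> p * y - q * x \<and>
      y + int n * (p * y - q * x) = q * int m}" (is "_ = ?S") for m
  proof (intro set_eqI iffI)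
    fix z assume "z \<in> T1 m \<inter> U m"
    then show "z \<in> ?S" using T1 U by (cases z) (auto simp: b_def s1_def)
  next
    fix z assume "z \<in> ?S"
    then have z: "0 \<le> snd z" "0 \<le> s1 z" "b m z = 0"
      by (auto simp: s1_def b_def)
    then have "z \<in> T1 m" by (simp add: T1)
    moreover have "0 \<le> e m z"
    proof (rule pos[OF _ q])
      show "0 \<le> q * e m z" using rel3[of z m] z \<open>q' > 0\<close> by (metis add.right_neutral less_imp_le mult_nonneg_nonneg mult_zero_right)
    qed
    ultimately show "z \<in> T1 m \<inter> U m" using T1_below z by (simp add: U)
  qed
  show ?thesis
  proof (cases "k \<ge> 0")
    case True
    (* Q lies beyond PR or on it. D is PQR without the edge PR, which already belongs to OPR. *)
    define D where "D = (\<lambda>m::nat. {z. 0 \<le> s1 z \<and> s2 z < 0 \<and> s1 z - s2 z \<le> int m * k})"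
    have D: "z \<in> D m \<longleftrightarrow> 0 \<le> s1 z \<and> s2 z < 0 \<and> 0 \<le> e m z" for z m
      by (auto simp: D_def e_def mult.commute)
    have union: "T1 m \<union> U m = T2 m \<union> D m" for m
    proof (intro set_eqI iffI)
      fix z assume z: "z \<in> T1 m \<union> U m"
      then have "0 \<le> snd z" "r m z \<le> 0"
        using U_upper T1_below U T1 by blast+
      moreover have "0 \<le> s1 z \<and> 0 \<le> e m z" if "s2 z < 0"
      proof (cases "z \<in> T1 m")
        case True
        then have "0 \<le> q' * s1 z" "k * b m z \<le> 0"
          using T1 \<open>k \<ge> 0\<close> \<open>q' > 0\<close> by (simp_all add: sign)
        then have "0 \<le> q * e m z" using rel3[of z m] by linarith
        then have "0 \<le> e m z" by (rule pos[OF _ q])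
        then show ?thesis using True T1 by simp
      next
        case False
        then have "z \<in> U m" using z by simp
        then have "0 \<le> q * e m z" "0 \<le> k * b m z"
          using U \<open>k \<ge> 0\<close> q by (simp_all add: sign)
        then have "0 \<le> q' * s1 z" using rel3[of z m] by linarith
        then have "0 \<le> s1 z" by (rule pos[OF _ \<open>q' > 0\<close>])
        then show ?thesis using \<open>z \<in> U m\<close> U by simp
      qed
      ultimately show "z \<in> T2 m \<union> D m"
        unfolding Un_iff T2 D by linarith
    next
      fix z assume z: "z \<in> T2 m \<union> D m"
      have "0 \<le> snd z \<and> r m z \<le> 0 \<and> 0 \<le> s1 z \<and> (0 \<le> b m z \<longrightarrow> 0 \<le> e m z)"
      proof (cases "z \<in> T2 m")
        case True
        then have z2: "0 \<le> snd z" "0 \<le> s2 z" "r m z \<le> 0" using T2 by auto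
        then have "0 \<le> q * s2 z" "0 \<le> k * snd z" "0 \<le> q' * s2 z" "k * r m z \<le> 0"
          using q \<open>q' > 0\<close> \<open>k \<ge> 0\<close> by (simp_all add: sign)
        then have "0 \<le> q2 * s1 z" "0 \<le> q2 * e m z"
          using rel1[of z] rel4[of z m] by linarith+
        then have "0 \<le> s1 z" "0 \<le> e m z" using q2 by (simp_all add: zero_le_mult_iff)
        then show ?thesis using z2 by simp
      next
        case False
        then have z2: "0 \<le> s1 z" "s2 z < 0" "0 \<le> e m z" using z D by auto
        then have "0 \<le> q2 * s1 z" "q * s2 z < 0" "q' * s2 z < 0" "0 \<le> q2 * e m z"
          using q q2 \<open>q' > 0\<close> by (simp_all add: sign mult_pos_neg)
        then have "0 < k * snd z" "k * r m z < 0"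
          using rel1[of z] rel4[of z m] by linarith+
        then show ?thesis using z2 \<open>k \<ge> 0\<close> by (auto simp: zero_less_mult_iff mult_less_0_iff)
      qed
      then show "z \<in> T1 m \<union> U m"
        unfolding Un_iff T1 U by linarith
    qed
    have card_eq: "card (T2 m) + (m div n + 1) + card (D m) = card (T1 m) + card (U m)" for m
    proof -
      have "finite (D m)"
        using union[of m] fin fin_U by (metis finite_Un)
      then have "card (T2 m) + card (D m) = card (T2 m \<union> D m)"
        using fin T2 D by (intro card_Un_disjoint[symmetric]) force+
      then show ?thesis
        using card_Un_Int[OF fin(1) fin_U, of m m] inter[of m]
          card_diagonal_points[OF n q cop, of m] union[of m] by simp
    qed
    have D_eq: "D m = {(x, y). 0 \<le> p * y - q * x \<and> p2 * y - q2 * x < 0 \<and>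
        (p * y - q * x) - (p2 * y - q2 * x) \<le> int m * k - 0}" for m
      by (auto simp: D_def s1_def s2_def)
    have "\<exists>A B. \<forall>m. real (card (D m)) = A * (real m)\<^sup>2 + B * real m"
    proof (cases "k = 0")
      case True
      then have "D m = {}" for m by (auto simp: D_def)
      then have "\<forall>m. real (card (D m)) = 0 * (real m)\<^sup>2 + 0 * real m" by simp
      then show ?thesis by blast
    next
      case False
      then show ?thesis
        using half_open_lattice_triangle_polynomial[of p q2 q p2 0] \<open>k \<ge> 0\<close>
        unfolding D_eq k_def by simp
    qed
    then obtain A B where AB: "\<And>m. real (card (D m)) = A * (real m)\<^sup>2 + B * real m" by blast
    have "\<forall>m. real (card (T2 m)) + real (m div n + 1) =
        real (card (T1 m)) + real (card (U m)) + (- A) * (real m)\<^sup>2 + (- B) * real m"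
    proof
      fix m
      have "real (card (T2 m)) + real (m div n + 1) + real (card (D m)) =
          real (card (T1 m)) + real (card (U m))"
        using card_eq[of m] by (metis of_nat_add)
      then show "real (card (T2 m)) + real (m div n + 1) =
          real (card (T1 m)) + real (card (U m)) + (- A) * (real m)\<^sup>2 + (- B) * real m"
        using AB[of m] by linarith
    qed
    then show ?thesis unfolding T1_def T2_def U_def by blast
  next
    case False
    (* Q lies inside OPR. D is PQR without the edges PQ and QR, which already belong to OPQ and
       OQR; strictness on the edge QR is the subtrahend 1. *)
    define D where "D = (\<lambda>m::nat. {z. 0 \<le> s2 z \<and> s1 z < 0 \<and> s2 z - s1 z \<le> int m * (- k) - 1})"
    have D: "z \<in> D m \<longleftrightarrow> 0 \<le> s2 z \<and> s1 z < 0 \<and> e m z < 0" for z m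
      by (auto simp: D_def e_def mult.commute)
    have union: "T2 m = T1 m \<union> U m \<union> D m" for m
    proof (intro set_eqI iffI)
      fix z assume "z \<in> T2 m"
      then have z: "0 \<le> snd z" "0 \<le> s2 z" "r m z \<le> 0" using T2 by auto
      have "0 \<le> e m z" if "0 \<le> s1 z" "0 \<le> b m z"
      proof (rule pos[OF _ q])
        have "0 \<le> q' * s1 z" "k * b m z \<le> 0"
          using that False \<open>q' > 0\<close> by (simp_all add: sign)
        then show "0 \<le> q * e m z" using rel3[of z m] by linarith
      qed
      moreover have "0 \<le> s1 z" if "0 \<le> e m z" "b m z \<le> 0"
      proof (rule pos[OF _ \<open>q' > 0\<close>])
        have "0 \<le> q * e m z" "0 \<le> k * b m z"
          using that False q by (simp_all add: sign)
        then show "0 \<le> q' * s1 z" using rel3[of z m] by linarith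
      qed
      ultimately show "z \<in> T1 m \<union> U m \<union> D m"
        using z unfolding Un_iff T1 U D by linarith
    next
      fix z assume "z \<in> T1 m \<union> U m \<union> D m"
      then consider "z \<in> T1 m" | "z \<in> U m" | "z \<in> D m" by blast
      then show "z \<in> T2 m"
      proof cases
        case 1
        then have "0 \<le> q2 * s1 z" "k * snd z \<le> 0"
          using T1 q2 False by (simp_all add: sign)
        then have "0 \<le> q * s2 z" using rel1[of z] by linarith
        then have "0 \<le> s2 z" by (rule pos[OF _ q])
        then show ?thesis using 1 T1 T2 T1_below by simp
      next
        case 2
        then have "0 \<le> q2 * e m z" "0 \<le> k * r m z"
          using U q2 False by (simp_all add: sign)
        then have "0 \<le> q' * s2 z" using rel4[of z m] by linarith
        then have "0 \<le> s2 z" by (rule pos[OF _ \<open>q' > 0\<close>])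
        then show ?thesis using 2 U T2 U_upper[OF 2] by simp
      next
        case 3
        then have "q2 * s1 z < 0" "0 \<le> q * s2 z" "0 \<le> q' * s2 z" "q2 * e m z < 0"
          using D q q2 \<open>q' > 0\<close> by (simp_all add: sign mult_pos_neg)
        then have "k * snd z < 0" "0 < k * r m z"
          using rel1[of z] rel4[of z m] by linarith+
        then show ?thesis using 3 D T2 False by (auto simp: zero_less_mult_iff mult_less_0_iff)
      qed
    qed
    have card_eq: "card (T2 m) + (m div n + 1) = card (T1 m) + card (U m) + card (D m)" for m
    proof -
      have "finite (D m)"
        using union[of m] fin by (metis finite_Un)
      moreover have "(T1 m \<union> U m) \<inter> D m = {}"
        using T1 U D by force
      ultimately have "card (T2 m) = card (T1 m \<union> U m) + card (D m)"
        unfolding union using fin fin_U by (subst card_Un_disjoint) auto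
      then show ?thesis
        using card_Un_Int[OF fin(1) fin_U, of m m] inter[of m]
          card_diagonal_points[OF n q cop, of m] by simp
    qed
    have D_eq: "D m = {(x, y). 0 \<le> p2 * y - q2 * x \<and> p * y - q * x < 0 \<and>
        (p2 * y - q2 * x) - (p * y - q * x) \<le> int m * (p2 * q - q2 * p) - 1}" for m
      by (auto simp: D_def s1_def s2_def k_def algebra_simps)
    obtain A B where AB: "\<And>m. real (card (D m)) = A * (real m)\<^sup>2 + B * real m"
      using half_open_lattice_triangle_polynomial[of p2 q q2 p 1] False
      unfolding D_eq k_def by (auto simp: mult.commute)
    have "\<forall>m. real (card (T2 m)) + real (m div n + 1) =
        real (card (T1 m)) + real (card (U m)) + A * (real m)\<^sup>2 + B * real m"
    proof
      fix m
      have "real (card (T2 m)) + real (m div n + 1) =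
          real (card (T1 m)) + real (card (U m)) + real (card (D m))"
        using card_eq[of m] by (metis of_nat_add)
      then show "real (card (T2 m)) + real (m div n + 1) =
          real (card (T1 m)) + real (card (U m)) + A * (real m)\<^sup>2 + B * real m"
        using AB[of m] by linarith
    qed
    then show ?thesis unfolding T1_def T2_def U_def by blast
  qed
qed

section \<open>Lattice points and denominators of the scaled triangles\<close>

lemma vector2_eq_iff: "(vector [x, y] :: real^2) = vector [x', y'] \<longleftrightarrow> x = x' \<and> y = y'"
  by (metis vector_2)

lemma dilate_scaled_sl2_triangle:
  assumes n: "n > 0" and a: "\<gamma>$1$1 = 1 + int n * p" and c: "\<gamma>$2$1 = int n * q"
  shows "dilate (real m) (dilate (inverse (real n)) (sl2_triangle \<gamma>)) =
    convex hull {vector [0, 0], vector [real m * of_int p, real m * of_int q],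
      vector [- (real m / real n), 0]}"
proof -
  have "r *\<^sub>R (vector [x, y] :: real^2) = vector [r * x, r * y]" for r x y
    by (simp add: vec_eq_iff forall_2)
  moreover have "dilate (real m) (dilate (inverse (real n)) (sl2_triangle \<gamma>)) =
      (\<lambda>x. (real m / real n) *\<^sub>R x) ` sl2_triangle \<gamma>"
    by (simp add: dilate_def image_image divide_inverse)
  ultimately show ?thesis
    using n unfolding sl2_triangle_def convex_hull_scaling[symmetric] by (simp add: a c)
qed

text \<open>
  The three inequalities express that the barycentric coordinates are nonnegative.
\<close>
lemma vector_mem_scaled_triangle_iff:
  fixes x y p q :: real
  assumes n: "n > 0" and q: "q > 0"
  shows "vector [x, y] \<in> convex hull {vector [0, 0], vector [real m * p, real m * q],
      vector [- (real m / real n), 0] :: real^2} \<longleftrightarrow>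
    0 \<le> y \<and> 0 \<le> p * y - q * x \<and> y + real n * (p * y - q * x) \<le> q * real m"
proof -
  have comb: "u *\<^sub>R vector [0, 0] + v *\<^sub>R vector [real m * p, real m * q] +
      w *\<^sub>R vector [- (real m / real n), 0] =
      (vector [v * (real m * p) - w * (real m / real n), v * (real m * q)] :: real^2)" for u v w
    by (simp add: vec_eq_iff forall_2)
  show ?thesis (is "_ \<longleftrightarrow> ?rhs")
    unfolding convex_hull_3 mem_Collect_eq comb vector2_eq_iff
  proof
    assume "\<exists>u v w. (x = v * (real m * p) - w * (real m / real n) \<and> y = v * (real m * q)) \<and>
        0 \<le> u \<and> 0 \<le> v \<and> 0 \<le> w \<and> u + v + w = 1"
    then obtain u v w where uvw: "0 \<le> u" "0 \<le> v" "0 \<le> w" "u + v + w = 1"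
      and x: "x = v * (real m * p) - w * (real m / real n)" and y: "y = v * (real m * q)"
      by blast
    have s: "p * y - q * x = w * real m * q / real n"
      by (simp add: x y algebra_simps)
    have "(v + w) * (real m * q) \<le> 1 * (real m * q)"
      using uvw q by (intro mult_right_mono) auto
    then show ?rhs
      unfolding s using uvw n q by (simp add: y algebra_simps)
  next
    assume rhs: ?rhs
    (* For m = 0 the denominators vanish; then v = w = 0, which is the right value for the
       degenerate triangle. *)
    define v where "v = y / (real m * q)"
    define w where "w = real n * (p * y - q * x) / (real m * q)"
    have "0 \<le> v" "0 \<le> w" using rhs q by (simp_all add: v_def w_def)
    moreover have "v + w \<le> 1"
    proof -
      have "v + w = (y + real n * (p * y - q * x)) / (real m * q)"
        by (simp add: v_def w_def add_divide_distrib)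
      also have "\<dots> \<le> 1"
        using rhs q by (cases "m = 0") (simp_all add: mult.commute)
      finally show ?thesis .
    qed
    moreover have "x = v * (real m * p) - w * (real m / real n) \<and> y = v * (real m * q)"
    proof (cases "m = 0")
      case True
      have "0 \<le> y" "0 \<le> real n * (p * y - q * x)" "y + real n * (p * y - q * x) \<le> 0"
        using rhs True by simp_all
      then have "y = 0" "real n * (p * y - q * x) = 0" by linarith+
      then show ?thesis using True n q by simp
    next
      case False
      then show ?thesis using n q by (simp add: v_def w_def field_simps)
    qed
    ultimately show "\<exists>u v w. (x = v * (real m * p) - w * (real m / real n) \<and> y = v * (real m * q)) \<and>
        0 \<le> u \<and> 0 \<le> v \<and> 0 \<le> w \<and> u + v + w = 1"
      by (intro exI[of _ "1 - v - w"] exI[of _ v] exI[of _ w]) auto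
  qed
qed

lemma lattice_count_scaled_sl2_triangle:
  assumes n: "n > 0" and a: "\<gamma>$1$1 = 1 + int n * p" and c: "\<gamma>$2$1 = int n * q" and q: "q > 0"
  shows "lattice_count (dilate (inverse (real n)) (sl2_triangle \<gamma>)) m = card (triangle_points n p q m)"
proof -
  define emb where "emb = (\<lambda>(x, y). vector [of_int x, of_int y] :: real^2)"
  have lattice_eq: "int_lattice = range emb"
  proof (intro set_eqI iffI)
    fix z :: "real^2" assume "z \<in> int_lattice"
    then obtain x y where "z$1 = of_int x" "z$2 = of_int y"
      by (auto simp: int_lattice_def forall_2 elim!: Ints_cases)
    then have "z = emb (x, y)" by (simp add: emb_def vec_eq_iff forall_2)
    then show "z \<in> range emb" by blast
  qed (auto simp: emb_def int_lattice_def forall_2)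
  have mem: "emb (x, y) \<in> dilate (real m) (dilate (inverse (real n)) (sl2_triangle \<gamma>)) \<longleftrightarrow>
      (x, y) \<in> triangle_points n p q m" for x y
  proof -
    have "emb (x, y) \<in> dilate (real m) (dilate (inverse (real n)) (sl2_triangle \<gamma>)) \<longleftrightarrow>
        real_of_int 0 \<le> of_int y \<and> real_of_int 0 \<le> of_int (p * y - q * x) \<and>
        real_of_int (y + int n * (p * y - q * x)) \<le> real_of_int (q * int m)"
      using vector_mem_scaled_triangle_iff[OF n, of "of_int q" "of_int x" "of_int y" m "of_int p"] q
      by (simp add: dilate_scaled_sl2_triangle[OF n a c] emb_def)
    then show ?thesis
      unfolding of_int_le_iff by (simp add: triangle_points_def)
  qed
  have "{z. emb z \<in> dilate (real m) (dilate (inverse (real n)) (sl2_triangle \<gamma>))} =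
      triangle_points n p q m"
    using mem by auto
  then have "int_lattice \<inter> dilate (real m) (dilate (inverse (real n)) (sl2_triangle \<gamma>)) =
      emb ` triangle_points n p q m"
    unfolding lattice_eq by blast
  moreover have "inj emb"
    by (auto simp: emb_def inj_def vector2_eq_iff)
  ultimately show ?thesis
    by (simp add: lattice_count_def card_image inj_on_subset[OF \<open>inj emb\<close>])
qed

text \<open>
  The vertex \<open>(- D / n, 0)\<close> of the \<open>D\<close>-fold dilate is integral only if \<open>n\<close> divides \<open>D\<close>, and for
  \<open>D = n\<close> all vertices are integral. The work lies in showing that this point is an extreme
  point, since the denominator is defined through extreme points.
\<close>
lemma den_scaled_sl2_triangle:
  assumes n: "n > 0" and a: "\<gamma>$1$1 = 1 + int n * p" and c: "\<gamma>$2$1 = int n * q" and q: "q > 0"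
  defines "T \<equiv> dilate (inverse (real n)) (sl2_triangle \<gamma>)"
  shows "den T > 0" and "n dvd den T"
proof -
  let ?P = "\<lambda>D. D > 0 \<and> (\<forall>v. v extreme_point_of dilate (real D) T \<longrightarrow> v \<in> int_lattice)"
  have hull: "dilate (real D) T = convex hull {vector [0, 0], vector [real D * of_int p, real D * of_int q],
      vector [- (real D / real n), 0]}" for D
    unfolding T_def by (rule dilate_scaled_sl2_triangle[OF n a c])
  have "?P n"
  proof (intro conjI allI impI)
    fix v assume "v extreme_point_of dilate (real n) T"
    then have "v \<in> {vector [0, 0], vector [real n * of_int p, real n * of_int q], vector [- 1, 0]}"
      using n unfolding hull by (auto dest!: extreme_point_of_convex_hull)
    then show "v \<in> int_lattice"
      by (auto simp: int_lattice_def forall_2)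
  qed (use n in simp)
  then have den: "?P (den T)"
    unfolding den_def by (rule LeastI)
  then show "den T > 0" by simp
  define w where "w = (vector [- (real (den T) / real n), 0] :: real^2)"
  have "w \<notin> convex hull {vector [0, 0], vector [real (den T) * of_int p, real (den T) * of_int q]}"
  proof
    assume "w \<in> convex hull {vector [0, 0], vector [real (den T) * of_int p, real (den T) * of_int q]}"
    then obtain u v where uv: "w = u *\<^sub>R vector [0, 0] + v *\<^sub>R vector [real (den T) * of_int p, real (den T) * of_int q]"
      unfolding convex_hull_2 by blast
    then have "w$2 = v * (real (den T) * of_int q)" "w$1 = v * (real (den T) * of_int p)" by simp_all
    then have "v = 0" "w$1 = 0" using den q by (auto simp: w_def)
    then show False using den n by (simp add: w_def)
  qed
  then have "w extreme_point_of convex hull insert w {vector [0, 0], vector [real (den T) * of_int p, real (den T) * of_int q]}"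
    by (intro extreme_point_of_convex_hull_insert) auto
  also have "convex hull insert w {vector [0, 0], vector [real (den T) * of_int p, real (den T) * of_int q]}
      = dilate (real (den T)) T"
    unfolding hull w_def by (simp add: insert_commute)
  finally have "w \<in> int_lattice" using den by blast
  then have "- (real (den T) / real n) \<in> \<int>"
    by (auto simp: int_lattice_def w_def forall_2)
  then obtain j where "real (den T) / real n = of_int j"
    by (metis Ints_cases Ints_minus minus_minus)
  then have "real (den T) = of_int j * real n" using n by (simp add: field_simps)
  then have "real_of_int (int (den T)) = real_of_int (j * int n)" by simp
  then have "int (den T) = j * int n" by (simp only: of_int_eq_iff)
  then show "n dvd den T" by (metis dvd_triv_right int_dvd_int_iff)
qed

section \<open>The constant Ehrhart coefficient\<close>

text \<open>
  On the progression \<open>m\<close>, \<open>m + den T\<close>, \<open>m + 2 * den T\<close> all coefficients are fixed, and a quadratic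
  polynomial with three distinct zeros vanishes. So the coefficients are unique.
\<close>
lemma G\<^sub>0_eqI:
  assumes coeffs: "ehrhart_coeffs T g h k" and den: "den T > 0"
  shows "G\<^sub>0 T = g"
  unfolding G\<^sub>0_def
proof (rule the_equality)
  show "\<exists>g\<^sub>1 g\<^sub>2. ehrhart_coeffs T g g\<^sub>1 g\<^sub>2" using coeffs by blast
  fix g' assume "\<exists>g\<^sub>1 g\<^sub>2. ehrhart_coeffs T g' g\<^sub>1 g\<^sub>2"
  then obtain h' k' where coeffs': "ehrhart_coeffs T g' h' k'" by blast
  show "g' = g"
  proof
    fix m
    define d where "d = real (den T)"
    have "d > 0" using den by (simp add: d_def)
    define A B C where "A = k m - k' m" and "B = h m - h' m" and "C = g m - g' m"
    have per: "g (m + i * den T) = g m \<and> h (m + i * den T) = h m \<and> k (m + i * den T) = k m \<and>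
        g' (m + i * den T) = g' m \<and> h' (m + i * den T) = h' m \<and> k' (m + i * den T) = k' m" for i
    proof (induction i)
      case (Suc i)
      have "m + Suc i * den T = m + i * den T + den T" by simp
      then show ?case using Suc coeffs coeffs' unfolding ehrhart_coeffs_def by presburger
    qed simp
    have zero: "A * (real m + real i * d)\<^sup>2 + B * (real m + real i * d) + C = 0" for i
    proof -
      have "real (lattice_count T (m + i * den T)) =
          k m * (real m + real i * d)\<^sup>2 + h m * (real m + real i * d) + g m"
        using coeffs per[of i] unfolding ehrhart_coeffs_def by (simp add: d_def)
      moreover have "real (lattice_count T (m + i * den T)) =
          k' m * (real m + real i * d)\<^sup>2 + h' m * (real m + real i * d) + g' m"
        using coeffs' per[of i] unfolding ehrhart_coeffs_def by (simp add: d_def)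
      ultimately show ?thesis by (simp add: A_def B_def C_def algebra_simps)
    qed
    note zeros = zero[of 0] zero[of 1] zero[of 2]
    (* The leading coefficient is recovered from the second difference with step d. *)
    have "2 * d\<^sup>2 * A =
        (A * (real m + real 2 * d)\<^sup>2 + B * (real m + real 2 * d) + C)
        - 2 * (A * (real m + real 1 * d)\<^sup>2 + B * (real m + real 1 * d) + C)
        + (A * (real m + real 0 * d)\<^sup>2 + B * (real m + real 0 * d) + C)"
      by (simp add: power2_eq_square algebra_simps)
    also have "\<dots> = 0" unfolding zeros by simp
    finally have "2 * d\<^sup>2 * A = 0" .
    then have "A = 0" using \<open>d > 0\<close> by simp
    have "d * B = (B * (real m + real 1 * d) + C) - (B * (real m + real 0 * d) + C)"
      by (simp add: algebra_simps)
    also have "\<dots> = 0" using zeros \<open>A = 0\<close> by simp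
    finally have "B = 0" using \<open>d > 0\<close> by simp
    with \<open>A = 0\<close> have "C = 0" using zeros by simp
    then show "g' m = g m" by (simp add: C_def)
  qed
qed

lemma period_dvd:
  fixes g :: "nat \<Rightarrow> 'a"
  assumes "\<And>m. g (m + n) = g m" and "n dvd d"
  shows "g (m + d) = g m"
proof -
  have "g (m + n * i) = g m" for i
  proof (induction i)
    case (Suc i)
    have "m + n * Suc i = (m + n * i) + n" by simp
    then show ?case using Suc assms(1) by presburger
  qed simp
  with \<open>n dvd d\<close> show ?thesis by (auto simp: dvd_def)
qed

text \<open>
  A description of the counting function with period \<open>n\<close> is enough, because \<open>n\<close> divides the denominator.
\<close>
lemma G\<^sub>0_scaled_sl2_triangle_eqI:
  assumes n: "n > 0" and a: "\<gamma>$1$1 = 1 + int n * p" and c: "\<gamma>$2$1 = int n * q" and q: "q > 0"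
    and per: "\<And>m. g (m + n) = g m"
    and count: "\<And>m. real (card (triangle_points n p q m)) = A * (real m)\<^sup>2 + B * real m + g m"
  shows "G\<^sub>0 (dilate (inverse (real n)) (sl2_triangle \<gamma>)) = g"
proof (rule G\<^sub>0_eqI)
  show "ehrhart_coeffs (dilate (inverse (real n)) (sl2_triangle \<gamma>)) g (\<lambda>_. B) (\<lambda>_. A)"
    unfolding ehrhart_coeffs_def lattice_count_scaled_sl2_triangle[OF n a c q] count
    using period_dvd[of g n, OF per den_scaled_sl2_triangle(2)[OF n a c q]] by simp
qed (rule den_scaled_sl2_triangle(1)[OF n a c q])

section \<open>Transport to the adjacent triangle\<close>

text \<open>
  In the frame with origin \<open>P\<close>, the map \<open>z \<mapsto> \<gamma> z + m (p, q)\<close> carries the triangle of \<open>\<gamma>'\<close>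
  to \<open>O Q R\<close>. It preserves the lattice since the translation vector, \<open>m / n\<close> times
  \<open>\<gamma> e - e\<close>, is integral.
\<close>
lemma card_adjacent_triangle_points:
  fixes a b c d p q p' q' :: int
  assumes det: "a * d - b * c = 1" and a: "a = 1 + int n * p" and c: "c = int n * q"
  shows "card (adjacent_triangle_points n p q (p + a * p' + b * q') (q + c * p' + d * q') m) =
    card (triangle_points n p' q' m)"
proof -
  define p2 where "p2 = p + a * p' + b * q'"
  define q2 where "q2 = q + c * p' + d * q'"
  define F where "F = (\<lambda>(x, y). (int m * p + (a * x + b * y), int m * q + (c * x + d * y)))"
  define G where "G = (\<lambda>(x, y). (d * (x - int m * p) - b * (y - int m * q),
    a * (y - int m * q) - c * (x - int m * p)))"
  have mem: "F (x, y) \<in> adjacent_triangle_points n p q p2 q2 m \<longleftrightarrow> (x, y) \<in> triangle_points n p' q' m" for x y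
  proof -
    define X where "X = int m * p + (a * x + b * y)"
    define Y where "Y = int m * q + (c * x + d * y)"
    (* Each edge function of OQR, evaluated at the image point, is the corresponding edge
       function of the triangle of the second matrix, because the determinant is 1. *)
    have "Y + int n * (p * Y - q * X) - q * int m = (a * d - b * c) * y"
      by (simp add: X_def Y_def a c algebra_simps)
    then have 1: "Y + int n * (p * Y - q * X) - q * int m = y" by (simp add: det)
    have "(p2 * Y - q2 * X) - (p * Y - q * X) + (p * q2 - q * p2) * int m =
        (a * d - b * c) * (p' * y - q' * x)"
      by (simp add: X_def Y_def p2_def q2_def algebra_simps)
    then have 2: "(p2 * Y - q2 * X) - (p * Y - q * X) + (p * q2 - q * p2) * int m = p' * y - q' * x"
      by (simp add: det)
    have "q2 - q + int n * (p * q2 - q * p2) = (a * d - b * c) * q'"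
      by (simp add: p2_def q2_def a c algebra_simps)
    then have 3: "q2 - q + int n * (p * q2 - q * p2) = q'" by (simp add: det)
    have "Y + int n * (p2 * Y - q2 * X) - q2 * int m =
        (Y + int n * (p * Y - q * X) - q * int m) +
        int n * ((p2 * Y - q2 * X) - (p * Y - q * X) + (p * q2 - q * p2) * int m) -
        (q2 - q + int n * (p * q2 - q * p2)) * int m"
      by (simp add: algebra_simps)
    then have 4: "Y + int n * (p2 * Y - q2 * X) - q2 * int m =
        y + int n * (p' * y - q' * x) - q' * int m"
      unfolding 1 2 3 .
    show ?thesis
      using 1 2 4 by (simp add: F_def adjacent_triangle_points_def triangle_points_def
        flip: X_def Y_def) linarith
  qed
  have GF: "G (F z) = z" and FG: "F (G z) = z" for z
  proof -
    have "G (F z) = ((a * d - b * c) * fst z, (a * d - b * c) * snd z)"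
      by (simp add: F_def G_def case_prod_beta algebra_simps)
    then show "G (F z) = z" by (simp add: det)
    have "F (G z) = (int m * p + (a * d - b * c) * (fst z - int m * p),
        int m * q + (a * d - b * c) * (snd z - int m * q))"
      by (simp add: F_def G_def case_prod_beta algebra_simps)
    then show "F (G z) = z" by (simp add: det)
  qed
  have "bij_betw F (triangle_points n p' q' m) (adjacent_triangle_points n p q p2 q2 m)"
  proof (rule bij_betw_byWitness[of _ G])
    show "F ` triangle_points n p' q' m \<subseteq> adjacent_triangle_points n p q p2 q2 m"
      using mem by auto
    show "G ` adjacent_triangle_points n p q p2 q2 m \<subseteq> triangle_points n p' q' m"
      using mem FG by (metis image_subsetI surj_pair)
  qed (use GF FG in auto)
  then show ?thesis
    by (simp add: bij_betw_same_card p2_def q2_def)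
qed

theorem theorem3:
  fixes \<gamma> \<gamma>' :: "int^2^2" and l :: int
  assumes "\<gamma> \<in> SL2Z" and "\<gamma>' \<in> SL2Z"
    and "l = gcd (sl2_content \<gamma>) (sl2_content \<gamma>')"
    and "\<gamma>$2$1 > 0"
    and "\<gamma>'$2$1 > 0"
    and "\<gamma>$2$1 * \<gamma>'$1$1 + \<gamma>$2$2 * \<gamma>'$2$1 > 0"
  shows "\<forall>m::nat.
    G\<^sub>0 (dilate (inverse (of_int l)) (sl2_triangle (\<gamma> ** \<gamma>'))) m =
      G\<^sub>0 (dilate (inverse (of_int l)) (sl2_triangle \<gamma>)) m
      + G\<^sub>0 (dilate (inverse (of_int l)) (sl2_triangle \<gamma>')) m
      + frac (real m / of_int l) - 1"
proof -
  define a b c d where "a = \<gamma>$1$1" and "b = \<gamma>$1$2" and "c = \<gamma>$2$1" and "d = \<gamma>$2$2"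
  define n where "n = nat l"
  have "l > 0"
    using assms(3,4) by (auto simp: sl2_content_def gcd_pos_int)
  then have n: "n > 0" and l: "l = int n" by (simp_all add: n_def)
  have "int n dvd sl2_content \<gamma>" "int n dvd sl2_content \<gamma>'"
    using assms(3) l by simp_all
  then have dvds: "int n dvd a - 1" "int n dvd c" "int n dvd \<gamma>'$1$1 - 1" "int n dvd \<gamma>'$2$1"
    by (auto simp: sl2_content_def a_def c_def)
  obtain p where "a - 1 = int n * p" using dvds(1) by blast
  then have a: "a = 1 + int n * p" by simp
  obtain q where c: "c = int n * q" using dvds(2) by blast
  obtain p' where "\<gamma>'$1$1 - 1 = int n * p'" using dvds(3) by blast
  then have a': "\<gamma>'$1$1 = 1 + int n * p'" by simp
  obtain q' where c': "\<gamma>'$2$1 = int n * q'" using dvds(4) by blast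
  have det: "a * d - b * c = 1"
    using assms(1) by (simp add: SL2Z_def det_2 a_def b_def c_def d_def)
  (* R - P = (Q - P) + (R - Q), where R - Q is the image of n (p', q') under the first matrix. *)
  define p2 where "p2 = p + a * p' + b * q'"
  define q2 where "q2 = q + c * p' + d * q'"
  have a2: "(\<gamma> ** \<gamma>')$1$1 = 1 + int n * p2"
    by (simp add: matrix_matrix_mult_def sum_2 a' c' p2_def a algebra_simps flip: a_def b_def)
  have c2: "(\<gamma> ** \<gamma>')$2$1 = int n * q2"
    by (simp add: matrix_matrix_mult_def sum_2 a' c' q2_def c algebra_simps flip: c_def d_def)
  have "(\<gamma> ** \<gamma>')$2$1 > 0"
    using assms(6) by (simp add: matrix_matrix_mult_def sum_2)
  then have q2: "q2 > 0" using n unfolding c2 by (simp add: zero_less_mult_iff)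
  have q: "q > 0" using assms(4) n c by (simp add: zero_less_mult_iff c_def)
  have q': "q' > 0" using assms(5) n c' by (simp add: zero_less_mult_iff)
  have "q2 - q + int n * (p * q2 - q * p2) = (a * d - b * c) * q'"
    by (simp add: p2_def q2_def a c algebra_simps)
  then have q'_eq: "q2 - q + int n * (p * q2 - q * p2) = q'" by (simp add: det)
  have "coprime a q"
  proof (rule coprimeI)
    fix j assume "j dvd a" "j dvd q"
    then have "j dvd a * d - b * c" unfolding c by (intro dvd_diff) (auto intro: dvd_mult dvd_mult2)
    then show "is_unit j" by (simp add: det)
  qed
  then obtain A B where cut: "\<And>m. real (card (triangle_points n p2 q2 m)) + real (m div n + 1) =
      real (card (triangle_points n p q m)) + real (card (adjacent_triangle_points n p q p2 q2 m))
      + A * (real m)\<^sup>2 + B * real m"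
    using triangle_points_cut_and_paste[OF n q q2, of p p2] q' unfolding q'_eq a by blast
  obtain A1 B1 g1 where g1: "\<And>m. g1 (m + n) = g1 m"
    "\<And>m. real (card (triangle_points n p q m)) = A1 * (real m)\<^sup>2 + B1 * real m + g1 m"
    using triangle_points_quasi_polynomial[OF n q] by blast
  obtain A2 B2 g2 where g2: "\<And>m. g2 (m + n) = g2 m"
    "\<And>m. real (card (triangle_points n p' q' m)) = A2 * (real m)\<^sup>2 + B2 * real m + g2 m"
    using triangle_points_quasi_polynomial[OF n q'] by blast
  have frac_eq: "frac (real m / real n) = real m / real n - real (m div n)" for m
    by (simp add: frac_def floor_divide_of_nat_eq)
  have "G\<^sub>0 (dilate (inverse (real n)) (sl2_triangle (\<gamma> ** \<gamma>'))) =
      (\<lambda>m. g1 m + g2 m + frac (real m / real n) - 1)"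
  proof (rule G\<^sub>0_scaled_sl2_triangle_eqI[OF n a2 c2 q2])
    show "g1 (m + n) + g2 (m + n) + frac (real (m + n) / real n) - 1 =
        g1 m + g2 m + frac (real m / real n) - 1" for m
      unfolding frac_eq g1(1) g2(1) using n by (simp add: add_divide_distrib)
    have "real (card (adjacent_triangle_points n p q p2 q2 m)) = A2 * (real m)\<^sup>2 + B2 * real m + g2 m" for m
      unfolding p2_def q2_def card_adjacent_triangle_points[OF det a c] by (rule g2(2))
    (* The floor m div n on the diagonal splits into the linear term m / n and the fractional
       part that the theorem exhibits. *)
    then show "real (card (triangle_points n p2 q2 m)) =
        (A1 + A2 + A) * (real m)\<^sup>2 + (B1 + B2 + B - 1 / real n) * real m +
        (g1 m + g2 m + frac (real m / real n) - 1)" for m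
      using cut[of m] unfolding g1(2) frac_eq by (simp add: algebra_simps)
  qed
  moreover have "G\<^sub>0 (dilate (inverse (real n)) (sl2_triangle \<gamma>)) = g1"
    using G\<^sub>0_scaled_sl2_triangle_eqI[OF n _ _ q g1] a c by (simp add: a_def c_def)
  moreover have "G\<^sub>0 (dilate (inverse (real n)) (sl2_triangle \<gamma>')) = g2"
    by (rule G\<^sub>0_scaled_sl2_triangle_eqI[OF n a' c' q' g2])
  ultimately show ?thesis
    by (simp add: l)
qed

end
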